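(* Let $K$ be a finitely ramified self-similar set with respect to injective contractions $f_1,\dots,f_m$, and let $G_n$ ($n\ge0$) be its approximating graphs with vertex sets $V_n$; $m$ is the number of $0$-cells (copies of $G_0$) of $G_1$. (1) If $G_1$ is a tree, then $\tau(G_n)=1$ for all $n\ge0$. (2) If $G_1$ is not a tree and $|V_0|>2$, then $\log\tau(G_n)\in\Theta(|V_n|)=\Theta(m^n)$ and $$\frac{\log 3}{2}\le\liminf_{n\to\infty}\frac{\log\tau(G_n)}{|V_n|}\le\limsup_{n\to\infty}\frac{\log\tau(G_n)}{|V_n|}\le\log\left(\frac{(m-1)|V_0|(|V_0|-1)}{|V_1|-|V_0|}\right).$$
   Context: $(X,d)$ complete metric space, $f_1,\dots,f_m$ injective contractions, $K$ the unique nonempty compact set with $K=\bigcup_i f_i(K)$. $F_0$ is the set of fixed points of the $f_i$; for a word $\omega=\omega_1\cdots\omega_n$, $f_\omega=f_{\omega_1}\circ\dots\circ f_{\omega_n}$, $K_\omega=f_\omega(K)$, $F_\omega=f_\omega(F_0)$. $K$ is finitely ramified if $K_\omega\cap K_{\omega'}=F_\omega\cap F_{\omega'}$ for any two distinct words of the same length. Approximating graphs: $G_0$ is the complete graph on a vertex set $V_0$ (the boundary set), $V_n=\bigcup_{|\omega|=n}f_\omega(V_0)$, and the edge multiset of $G_n$ is the union over words $\omega$ of length $n$ of the images under $f_\omega$ of the edges of $G_0$ (so $G_n$ consists of $m^n$ copies of $G_0$, called $n$-cells, glued at vertices). The graphs $G_n$ are assumed connected and loopless. $\tau(G)$ denotes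 the number of spanning trees of $G$. *)

theory Defs
  imports "HOL-Analysis.Analysis" "HOL-Library.Landau_Symbols"
begin

section \<open>Undirected multigraphs and spanning trees\<close>

text \<open>
  Edges are labels, and \<open>mg_ends e\<close> is the set of endpoints of the edge \<open>e\<close>, so parallel edges
  are distinct labels with the same endpoints. (The trees of the AFP entry Graph\_Theory exclude
  only directed cycles, hence are not the trees of undirected multigraphs.)
\<close>

record ('v, 'e) multigraph =
  mg_verts :: "'v set"
  mg_edges :: "'e set"
  mg_ends :: "'e \<Rightarrow> 'v set"

definition mg_loopless :: "('v, 'e) multigraph \<Rightarrow> bool" where
  "mg_loopless G \<longleftrightarrow> (\<forall>e\<in>mg_edges G. card (mg_ends G e) = 2)"

definition mg_adj :: "('v, 'e) multigraph \<Rightarrow> ('v \<times> 'v) set" where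
  "mg_adj G = {(u, v). \<exists>e\<in>mg_edges G. mg_ends G e = {u, v}}"

definition mg_connected :: "('v, 'e) multigraph \<Rightarrow> bool" where
  "mg_connected G \<longleftrightarrow> mg_verts G \<noteq> {} \<and> (\<forall>u\<in>mg_verts G. \<forall>v\<in>mg_verts G. (u, v) \<in> (mg_adj G)\<^sup>*)"

text \<open>
  A loop is a cycle of length one, and two parallel edges form a cycle of length two.
\<close>

definition mg_cycle :: "('v, 'e) multigraph \<Rightarrow> 'v list \<Rightarrow> 'e list \<Rightarrow> bool" where
  "mg_cycle G vs es \<longleftrightarrow>
     es \<noteq> [] \<and> length vs = length es \<and> distinct vs \<and> distinct es \<and> set es \<subseteq> mg_edges G \<and>
     (\<forall>i<length es. mg_ends G (es ! i) = {vs ! i, vs ! (Suc i mod length es)})"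

definition mg_tree :: "('v, 'e) multigraph \<Rightarrow> bool" where
  "mg_tree G \<longleftrightarrow> mg_connected G \<and> (\<nexists>vs es. mg_cycle G vs es)"

text \<open>A spanning tree is identified with its set of edges.\<close>

definition spanning_trees :: "('v, 'e) multigraph \<Rightarrow> 'e set set" where
  "spanning_trees G = {T. T \<subseteq> mg_edges G \<and> mg_tree (G\<lparr>mg_edges := T\<rparr>)}"

definition tau :: "('v, 'e) multigraph \<Rightarrow> nat" where
  "tau G = card (spanning_trees G)"


section \<open>Self-similar sets\<close>

definition injective_contraction :: "('a::metric_space \<Rightarrow> 'a) \<Rightarrow> bool" where
  "injective_contraction g \<longleftrightarrow> inj g \<and> (\<exists>c<1. c-lipschitz_on UNIV g)"

text \<open>
  In a complete space the set \<open>K\<close> below exists and is unique whenever \<open>m \<ge> 1\<close>.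
\<close>

definition self_similar_set :: "nat \<Rightarrow> (nat \<Rightarrow> 'a::metric_space \<Rightarrow> 'a) \<Rightarrow> 'a set \<Rightarrow> bool" where
  "self_similar_set m f K \<longleftrightarrow> compact K \<and> K \<noteq> {} \<and> K = (\<Union>i\<in>{1..m}. f i ` K)"

definition words :: "nat \<Rightarrow> nat \<Rightarrow> nat list set" where
  "words m n = {w. set w \<subseteq> {1..m} \<and> length w = n}"

text \<open>
  The map \<open>f\<^sub>\<omega>\<close> of a word \<open>\<omega> = \<omega>\<^sub>1 \<dots> \<omega>\<^sub>n\<close> is
  \<open>foldr f \<omega> = f \<omega>\<^sub>1 \<circ> \<dots> \<circ> f \<omega>\<^sub>n\<close>.
\<close>

abbreviation word_map :: "(nat \<Rightarrow> 'a \<Rightarrow> 'a) \<Rightarrow> nat list \<Rightarrow> 'a \<Rightarrow> 'a" where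
  "word_map f w \<equiv> foldr f w"

definition fixed_points :: "nat \<Rightarrow> (nat \<Rightarrow> 'a \<Rightarrow> 'a) \<Rightarrow> 'a set" where
  "fixed_points m f = {x. \<exists>i\<in>{1..m}. f i x = x}"

text \<open>
  Any two distinct cells of the same level meet exactly in the images of \<open>B\<close> they share.
\<close>

definition cells_meet_in :: "nat \<Rightarrow> (nat \<Rightarrow> 'a \<Rightarrow> 'a) \<Rightarrow> 'a set \<Rightarrow> 'a set \<Rightarrow> bool" where
  "cells_meet_in m f K B \<longleftrightarrow>
     (\<forall>n. \<forall>w\<in>words m n. \<forall>w'\<in>words m n. w \<noteq> w' \<longrightarrow>
        word_map f w ` K \<inter> word_map f w' ` K = word_map f w ` B \<inter> word_map f w' ` B)"

definition finitely_ramified :: "nat \<Rightarrow> (nat \<Rightarrow> 'a \<Rightarrow> 'a) \<Rightarrow> 'a set \<Rightarrow> bool" where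
  "finitely_ramified m f K \<longleftrightarrow> cells_meet_in m f K (fixed_points m f)"

text \<open>
  A boundary set is a finite subset of \<open>K\<close> through which the cells are glued. For a finitely
  ramified \<open>K\<close>, the set of all fixed points is one (see \<open>fixed_points_boundary_set\<close> below), and so
  is the set of essential fixed points, i.e. those \<open>x\<close> with \<open>f i x = f j y\<close> for some
  \<open>i \<noteq> j\<close> and some fixed point \<open>y\<close>.
\<close>

definition boundary_set :: "nat \<Rightarrow> (nat \<Rightarrow> 'a \<Rightarrow> 'a) \<Rightarrow> 'a set \<Rightarrow> 'a set \<Rightarrow> bool" where
  "boundary_set m f K V0 \<longleftrightarrow> finite V0 \<and> V0 \<subseteq> K \<and> cells_meet_in m f K V0"

lemma fixed_points_boundary_set:
  fixes f :: "nat \<Rightarrow> 'a::complete_space \<Rightarrow> 'a"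
  assumes f: "\<And>i. i \<in> {1..m} \<Longrightarrow> injective_contraction (f i)"
    and K: "self_similar_set m f K" and ram: "finitely_ramified m f K"
  shows "boundary_set m f K (fixed_points m f)"
proof -
  have uniq: "\<exists>y\<in>K. \<forall>x. f i x = x \<longrightarrow> x = y" if i: "i \<in> {1..m}" for i
  proof -
    obtain c where c: "c < 1" "c-lipschitz_on UNIV (f i)"
      using f[OF i] by (auto simp: injective_contraction_def)
    have c0: "0 \<le> c" and le: "dist (f i x) (f i y) \<le> c * dist x y" for x y
      using c(2) by (auto simp: lipschitz_on_def)
    have "f i ` K \<subseteq> (\<Union>i\<in>{1..m}. f i ` K)" using i by blast
    then have KK: "f i ` K \<subseteq> K" "complete K" "K \<noteq> {}"
      using K by (simp_all add: self_similar_set_def compact_imp_complete)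
    have "\<exists>!x\<in>K. f i x = x"
      by (rule Banach_fix[OF KK(2,3) c0 c(1) KK(1)]) (use le in auto)
    then obtain y where y: "y \<in> K" "f i y = y" by auto
    have "x = y" if "f i x = x" for x
    proof (rule ccontr)
      assume "x \<noteq> y"
      then have "c * dist x y < 1 * dist x y"
        using c(1) by (intro mult_strict_right_mono) auto
      then show False using le[of x y] that y(2) by simp
    qed
    with y(1) show ?thesis by blast
  qed
  then obtain p where p: "\<And>i. i \<in> {1..m} \<Longrightarrow> p i \<in> K \<and> (\<forall>x. f i x = x \<longrightarrow> x = p i)"
    by metis
  have "fixed_points m f \<subseteq> p ` {1..m}" using p by (fastforce simp: fixed_points_def)
  moreover have "p ` {1..m} \<subseteq> K" using p by auto
  ultimately show ?thesis
    using ram by (meson boundary_set_def finitely_ramified_def finite_atLeastAtMost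
        finite_imageI finite_subset subset_trans)
qed


section \<open>Approximating graphs\<close>

definition approx_verts :: "nat \<Rightarrow> (nat \<Rightarrow> 'a \<Rightarrow> 'a) \<Rightarrow> 'a set \<Rightarrow> nat \<Rightarrow> 'a set" where
  "approx_verts m f V0 n = (\<Union>w\<in>words m n. word_map f w ` V0)"

text \<open>
  The edge labelled \<open>(w, e)\<close> is the image under \<open>word_map f w\<close> of the edge \<open>e\<close> of the complete
  graph on \<open>V0\<close>. Edges of different cells are kept distinct even if they share both endpoints.
\<close>

definition approx_graph ::
  "nat \<Rightarrow> (nat \<Rightarrow> 'a \<Rightarrow> 'a) \<Rightarrow> 'a set \<Rightarrow> nat \<Rightarrow> ('a, nat list \<times> 'a set) multigraph" where
  "approx_graph m f V0 n =
     \<lparr> mg_verts = approx_verts m f V0 n,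
       mg_edges = words m n \<times> {e. e \<subseteq> V0 \<and> card e = 2},
       mg_ends = (\<lambda>(w, e). word_map f w ` e) \<rparr>"

end

theory Submission
  imports Defs "HOL-Real_Asymp.Real_Asymp"
begin

text \<open>
  A point glued at level 1 comes from points of \<open>V0\<close> that are vertices of every level, so each step
  loses the same number of vertices: \<open>|V (n + 1)| - |V 1| = m (|V n| - |V 0|)\<close>, and \<open>|V n|\<close> is affine in
  \<open>m ^ n\<close>. If \<open>G 1\<close> is a tree with \<open>|V 0| = 2\<close>, this gives \<open>|V n| = m ^ n + 1\<close>, one more than the
  number of edges of \<open>G n\<close>.

  For the upper bound, a spanning tree is recovered from the parent edge of every vertex, so \<open>\<tau>\<close> is
  at most the product of the degrees of the vertices other than a root, which AM-GM bounds by
  \<open>(2 |E| / (|V| - 1)) ^ (|V| - 1)\<close>. For the lower bound, every edge of \<open>G n\<close> lies in a triangle if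
  \<open>|V 0| > 2\<close>. A connected set of vertices can then be extended either by one vertex with two
  edges to it, or by two vertices forming a triangle with a vertex of it, which multiplies the
  number of spanning trees by at least \<open>2\<close> or \<open>3\<close>. Hence \<open>\<tau> \<ge> (\<surd>3) ^ (|V| - 1)\<close>.
\<close>

section \<open>Trees in finite multigraphs\<close>

locale finite_multigraph =
  fixes G :: "('v, 'e) multigraph"
  assumes finite_verts: "finite (mg_verts G)"
    and finite_edges: "finite (mg_edges G)"
    and ends_subset: "e \<in> mg_edges G \<Longrightarrow> mg_ends G e \<subseteq> mg_verts G"

lemma finite_multigraph_edges_subset:
  assumes "finite_multigraph G" "T \<subseteq> mg_edges G"
  shows "finite_multigraph (G\<lparr>mg_edges := T\<rparr>)"
  using assms by (auto simp: finite_multigraph_def intro: finite_subset)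

lemma sym_mg_adj: "sym (mg_adj G)"
  by (auto simp: sym_def mg_adj_def insert_commute)

lemma mg_adj_rtrancl_sym: "(u, v) \<in> (mg_adj G)\<^sup>* \<Longrightarrow> (v, u) \<in> (mg_adj G)\<^sup>*"
  by (meson sym_mg_adj sym_rtrancl symD)

lemma mg_connectedI_root:
  assumes "r \<in> mg_verts G" "\<And>v. v \<in> mg_verts G \<Longrightarrow> (r, v) \<in> (mg_adj G)\<^sup>*"
  shows "mg_connected G"
  unfolding mg_connected_def
  using assms by (metis empty_iff mg_adj_rtrancl_sym rtrancl_trans)

text \<open>Parent edges along shortest paths to the root \<open>r\<close>.\<close>

lemma (in finite_multigraph) parent_edges:
  assumes conn: "mg_connected G" and r: "r \<in> mg_verts G"
  obtains p where "inj_on p (mg_verts G - {r})"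
    and "\<And>v. v \<in> mg_verts G - {r} \<Longrightarrow> p v \<in> mg_edges G \<and> v \<in> mg_ends G (p v)"
    and "mg_connected (G\<lparr>mg_edges := p ` (mg_verts G - {r})\<rparr>)"
proof -
  let ?R = "mg_adj G" and ?V = "mg_verts G"
  define d where "d v = (LEAST n. (r, v) \<in> ?R ^^ n)" for v
  have dist_le: "d v \<le> n" if "(r, v) \<in> ?R ^^ n" for v n
    unfolding d_def using that by (rule Least_le)
  have dist: "(r, v) \<in> ?R ^^ d v" if "v \<in> ?V" for v
  proof -
    have "(r, v) \<in> ?R\<^sup>*" using conn r that by (auto simp: mg_connected_def)
    then obtain n where "(r, v) \<in> ?R ^^ n" using rtrancl_power by blast
    then show ?thesis unfolding d_def by (rule LeastI)
  qed
  have ex: "\<exists>u e. e \<in> mg_edges G \<and> mg_ends G e = {u, v} \<and> d v = Suc (d u)"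
    if v: "v \<in> ?V - {r}" for v
  proof -
    have "d v \<noteq> 0" using dist[of v] v by (intro notI) auto
    then obtain k where k: "d v = Suc k" using not0_implies_Suc by blast
    then obtain u where u: "(r, u) \<in> ?R ^^ k" "(u, v) \<in> ?R" using dist[of v] v by auto
    obtain e where e: "e \<in> mg_edges G" "mg_ends G e = {u, v}" using u(2) by (auto simp: mg_adj_def)
    have "u \<in> ?V" using ends_subset e by blast
    then have "(r, v) \<in> ?R ^^ Suc (d u)" using dist u(2) by auto
    then have "d u = k" using dist_le[OF u(1)] dist_le[of v "Suc (d u)"] k by simp
    then show ?thesis using e k by blast
  qed
  then obtain q p where pq: "\<And>v. v \<in> ?V - {r} \<Longrightarrow>
      p v \<in> mg_edges G \<and> mg_ends G (p v) = {q v, v} \<and> d v = Suc (d (q v))"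
    by metis
  \<comment> \<open>If distinct \<open>v\<close> and \<open>v'\<close> shared a parent edge, each
    would be the parent of the other, so each would be one step farther from \<open>r\<close> than
    the other.\<close>
  have inj: "inj_on p (?V - {r})"
  proof (rule inj_onI)
    fix v v' assume v: "v \<in> ?V - {r}" "v' \<in> ?V - {r}" "p v = p v'"
    then have "{q v, v} = {q v', v'}" using pq by metis
    then show "v = v'" using pq[OF v(1)] pq[OF v(2)] by (auto simp: doubleton_eq_iff)
  qed
  let ?P = "G\<lparr>mg_edges := p ` (?V - {r})\<rparr>"
  \<comment> \<open>Induction on the distance from \<open>r\<close>: the parent \<open>q v\<close>
    is strictly closer to the root.\<close>
  have "(r, v) \<in> (mg_adj ?P)\<^sup>*" if "v \<in> ?V" for v
    using that
  proof (induction "d v" arbitrary: v rule: less_induct)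
    case less
    show ?case
    proof (cases "v = r")
      case False
      then have v: "v \<in> ?V - {r}" using less by auto
      have q: "q v \<in> ?V" using pq[OF v] ends_subset by blast
      have "(q v, v) \<in> mg_adj ?P" using pq[OF v] v by (auto simp: mg_adj_def)
      then show ?thesis using less(1)[OF _ q] pq[OF v] by (simp add: rtrancl.rtrancl_into_rtrancl)
    qed auto
  qed
  then have "mg_connected ?P" using r by (intro mg_connectedI_root[of r]) auto
  then show thesis using that[OF inj] pq by blast
qed

text \<open>Parent edges inject the non-root vertices into the edges.\<close>

lemma (in finite_multigraph) connected_card_verts_le:
  assumes "mg_connected G"
  shows "card (mg_verts G) \<le> Suc (card (mg_edges G))"
proof -
  obtain r where r: "r \<in> mg_verts G" using assms by (auto simp: mg_connected_def)
  from parent_edges[OF assms r] obtain p where p: "inj_on p (mg_verts G - {r})"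
    "\<And>v. v \<in> mg_verts G - {r} \<Longrightarrow> p v \<in> mg_edges G"
    by metis
  then have "card (mg_verts G - {r}) \<le> card (mg_edges G)"
    by (intro card_inj_on_le[OF p(1)] finite_edges) auto
  then show ?thesis using r finite_verts by simp
qed

lemma rtrancl_simple_path:
  assumes "(a, b) \<in> R\<^sup>*"
  obtains n g where "g 0 = a" "g n = b" "\<And>i. i < n \<Longrightarrow> (g i, g (Suc i)) \<in> R" "inj_on g {..n}"
proof -
  define n where "n = (LEAST n. (a, b) \<in> R ^^ n)"
  have ex: "\<exists>n. (a, b) \<in> R ^^ n" using assms rtrancl_power by blast
  then have n: "(a, b) \<in> R ^^ n" unfolding n_def by (rule LeastI_ex)
  then obtain g where g: "g 0 = a" "g n = b" "\<And>i. i < n \<Longrightarrow> (g i, g (Suc i)) \<in> R"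
    by (auto simp: relpow_fun_conv)
  have "g i \<noteq> g j" if "i < j" "j \<le> n" for i j
  proof
    assume eq: "g i = g j"
    have 1: "(a, g i) \<in> R ^^ i" using g that unfolding relpow_fun_conv
      by (intro exI[of _ g]) auto
    have 2: "(g j, b) \<in> R ^^ (n - j)" using g that unfolding relpow_fun_conv
      by (intro exI[of _ "\<lambda>k. g (j + k)"]) auto
    \<comment> \<open>Cutting out the detour between the two visits would give a walk shorter than
      the minimal length \<open>n\<close>.\<close>
    have "(a, b) \<in> R ^^ (i + (n - j))" using 1 2 eq unfolding relpow_add by auto
    then have "n \<le> i + (n - j)" unfolding n_def by (rule Least_le)
    then show False using that by linarith
  qed
  then have "inj_on g {..n}"
    by (intro inj_onI) (metis atMost_iff linorder_neqE_nat)
  then show thesis using that g by blast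
qed

text \<open>A simple path of \<open>P\<close>-edges between the ends of \<open>e\<close> avoids
  \<open>e\<close>, so adding \<open>e\<close> closes it to a cycle. If \<open>a = b\<close>, the
  path is trivial and the cycle is the loop \<open>e\<close>.\<close>

lemma mg_cycle_insert_edge:
  assumes path: "(a, b) \<in> (mg_adj (G\<lparr>mg_edges := P\<rparr>))\<^sup>*"
    and P: "P \<subseteq> mg_edges G" and e: "e \<in> mg_edges G - P" "mg_ends G e = {a, b}"
  shows "\<exists>vs es. mg_cycle G vs es"
proof -
  obtain n g where g: "g 0 = a" "g n = b" "inj_on g {..n}"
    and adj: "\<And>i. i < n \<Longrightarrow> (g i, g (Suc i)) \<in> mg_adj (G\<lparr>mg_edges := P\<rparr>)"
    using rtrancl_simple_path[OF path] by metis
  have "\<exists>h. \<forall>i<n. h i \<in> P \<and> mg_ends G (h i) = {g i, g (Suc i)}"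
    using adj by (intro choice) (auto simp: mg_adj_def)
  then obtain h where h: "\<And>i. i < n \<Longrightarrow> h i \<in> P \<and> mg_ends G (h i) = {g i, g (Suc i)}" by blast
  \<comment> \<open>The path visits no vertex twice, so two of its edges with the same ends at
    different positions would need \<open>i = Suc j\<close> and \<open>j = Suc i\<close>.\<close>
  have inj: "inj_on h {..<n}"
  proof (rule inj_onI)
    fix i j assume ij: "i \<in> {..<n}" "j \<in> {..<n}" "h i = h j"
    then have "{g i, g (Suc i)} = {g j, g (Suc j)}" using h by (metis lessThan_iff)
    moreover have "g k = g l \<longleftrightarrow> k = l" if "k \<le> n" "l \<le> n" for k l
      using g(3) that by (auto simp: inj_on_def)
    ultimately have "i = j \<or> (i = Suc j \<and> Suc i = j)"
      using ij by (simp add: doubleton_eq_iff)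
    then show "i = j" by auto
  qed
  \<comment> \<open>There are \<open>n + 1\<close> vertices and \<open>n\<close> path edges;
    \<open>e\<close> takes index \<open>n\<close>, where the successor wraps around to
    \<open>a\<close>.\<close>
  let ?vs = "map g [0..<Suc n]" and ?es = "map h [0..<n] @ [e]"
  have "mg_cycle G ?vs ?es"
    unfolding mg_cycle_def
  proof (intro conjI allI impI)
    show "distinct ?vs" using g(3) by (simp only: distinct_map) (auto simp: inj_on_def)
    show "distinct ?es" using inj h e by (auto simp: distinct_map atLeast0LessThan)
    show "set ?es \<subseteq> mg_edges G" using h P e by auto
    fix i assume "i < length ?es"
    then consider "i < n" | "i = n" by fastforce
    then show "mg_ends G (?es ! i) = {?vs ! i, ?vs ! (Suc i mod length ?es)}"
    proof cases
      case 1
      then have *: "?es ! i = h i" "?vs ! i = g i" "Suc i mod length ?es = Suc i"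
        by (auto simp: nth_append simp del: upt_Suc)
      moreover have "?vs ! Suc i = g (Suc i)" using 1 by (simp del: upt_Suc)
      ultimately show ?thesis using h[OF 1] by simp
    next
      case 2
      then have *: "?es ! i = e" "?vs ! i = b" "Suc i mod length ?es = 0"
        using g by (auto simp: nth_append simp del: upt_Suc)
      moreover have "?vs ! 0 = a" using g by (simp del: upt_Suc)
      ultimately show ?thesis using e by (simp add: insert_commute del: upt_Suc)
    qed
  qed auto
  then show ?thesis by blast
qed

text \<open>The parent edges alone already connect all vertices, so any further edge would close a
  cycle with them.\<close>

lemma (in finite_multigraph) tree_parent_edges:
  assumes tree: "mg_tree G" and r: "r \<in> mg_verts G"
    and loopless: "mg_loopless G"
  obtains p where "inj_on p (mg_verts G - {r})" "mg_edges G = p ` (mg_verts G - {r})"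
    and "\<And>v. v \<in> mg_verts G - {r} \<Longrightarrow> v \<in> mg_ends G (p v)"
proof -
  have conn: "mg_connected G" and acyc: "\<nexists>vs es. mg_cycle G vs es"
    using tree by (auto simp: mg_tree_def)
  from parent_edges[OF conn r] obtain p where p: "inj_on p (mg_verts G - {r})"
    "\<And>v. v \<in> mg_verts G - {r} \<Longrightarrow> p v \<in> mg_edges G \<and> v \<in> mg_ends G (p v)"
    "mg_connected (G\<lparr>mg_edges := p ` (mg_verts G - {r})\<rparr>)"
    by metis
  have "mg_edges G \<subseteq> p ` (mg_verts G - {r})"
  proof (rule ccontr)
    assume "\<not> ?thesis"
    then obtain e where e: "e \<in> mg_edges G" "e \<notin> p ` (mg_verts G - {r})" by blast
    obtain a b where ab: "mg_ends G e = {a, b}"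
      using loopless e(1) by (auto simp: mg_loopless_def card_2_iff)
    have "a \<in> mg_verts G" "b \<in> mg_verts G" using ends_subset[OF e(1)] ab by auto
    then have "(a, b) \<in> (mg_adj (G\<lparr>mg_edges := p ` (mg_verts G - {r})\<rparr>))\<^sup>*"
      using p(3) by (auto simp: mg_connected_def)
    from mg_cycle_insert_edge[OF this _ _ ab] show False using acyc e p(2) by blast
  qed
  then have "mg_edges G = p ` (mg_verts G - {r})" using p(2) by blast
  then show thesis using that p by blast
qed

text \<open>This turns the absence of cycles into a count, the form in which trees are recognised
  below. Backwards, deleting an edge of a cycle would keep the graph connected but leave fewer edges
  than \<open>connected_card_verts_le\<close> allows.\<close>

lemma (in finite_multigraph) tree_iff_card:
  assumes loopless: "mg_loopless G"
  shows "mg_tree G \<longleftrightarrow> mg_connected G \<and> card (mg_verts G) = Suc (card (mg_edges G))"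
proof
  assume tree: "mg_tree G"
  then have conn: "mg_connected G" by (simp add: mg_tree_def)
  then obtain r where r: "r \<in> mg_verts G" by (auto simp: mg_connected_def)
  obtain p where "inj_on p (mg_verts G - {r})" "mg_edges G = p ` (mg_verts G - {r})"
    using tree_parent_edges[OF tree r loopless] by metis
  then have "card (mg_edges G) = card (mg_verts G - {r})" by (simp add: card_image)
  then have "card (mg_verts G) = Suc (card (mg_edges G))"
    using r finite_verts by (metis card.remove)
  then show "mg_connected G \<and> card (mg_verts G) = Suc (card (mg_edges G))" using conn by simp
next
  assume asm: "mg_connected G \<and> card (mg_verts G) = Suc (card (mg_edges G))"
  have False if cyc: "mg_cycle G vs es" for vs es
  proof -
    obtain n where n: "length es = Suc n"
      using cyc by (cases es) (auto simp: mg_cycle_def)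
    then have len: "length es = Suc n" "length vs = Suc n" and dist: "distinct es"
      and sub: "set es \<subseteq> mg_edges G"
      and ends: "\<And>i. i \<le> n \<Longrightarrow> mg_ends G (es ! i) = {vs ! i, vs ! (Suc i mod Suc n)}"
      using cyc by (auto simp: mg_cycle_def less_Suc_eq_le)
    let ?e = "es ! n"
    have e: "?e \<in> mg_edges G" using sub len by (metis lessI nth_mem subsetD)
    let ?H = "G\<lparr>mg_edges := mg_edges G - {?e}\<rparr>"
    \<comment> \<open>The rest of the cycle joins the ends of its last edge without using that
      edge.\<close>
    have path: "i \<le> n \<Longrightarrow> (vs ! 0, vs ! i) \<in> (mg_adj ?H)\<^sup>*" for i
    proof (induction i)
      case (Suc i)
      have "es ! i \<noteq> ?e" using dist len Suc by (simp add: nth_eq_iff_index_eq)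
      moreover have "es ! i \<in> mg_edges G" using sub len Suc by (metis le_imp_less_Suc nth_mem subsetD Suc_leD)
      moreover have "mg_ends G (es ! i) = {vs ! i, vs ! Suc i}" using ends[of i] Suc by simp
      ultimately have "(vs ! i, vs ! Suc i) \<in> mg_adj ?H" by (auto simp: mg_adj_def)
      then show ?case using Suc by (simp add: rtrancl.rtrancl_into_rtrancl)
    qed auto
    have e_path: "(vs ! 0, vs ! n) \<in> (mg_adj ?H)\<^sup>*" "mg_ends G ?e = {vs ! n, vs ! 0}"
      using path[of n] ends[of n] by auto
    \<comment> \<open>A step along the deleted edge is replaced by the detour around the
      cycle.\<close>
    have "mg_adj G \<subseteq> (mg_adj ?H)\<^sup>*"
    proof
      fix x assume "x \<in> mg_adj G"
      then obtain u v e' where x: "x = (u, v)" "e' \<in> mg_edges G" "mg_ends G e' = {u, v}"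
        by (auto simp: mg_adj_def)
      show "x \<in> (mg_adj ?H)\<^sup>*"
      proof (cases "e' = ?e")
        case True
        then have "(u = vs ! 0 \<and> v = vs ! n) \<or> (v = vs ! 0 \<and> u = vs ! n)"
          using x e_path by (auto simp: doubleton_eq_iff)
        then show ?thesis using e_path(1) mg_adj_rtrancl_sym[OF e_path(1)] x(1) by auto
      next
        case False
        then have "x \<in> mg_adj ?H" using x by (auto simp: mg_adj_def)
        then show ?thesis by auto
      qed
    qed
    then have "(mg_adj G)\<^sup>* \<subseteq> (mg_adj ?H)\<^sup>*"
      by (metis rtrancl_idemp rtrancl_mono)
    then have H_conn: "mg_connected ?H" using asm by (auto simp: mg_connected_def)
    interpret H: finite_multigraph ?H
      by (rule finite_multigraph_edges_subset) (auto intro: finite_multigraph_axioms)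
    have "card (mg_verts G) \<le> Suc (card (mg_edges G - {?e}))"
      using H.connected_card_verts_le[OF H_conn] by simp
    moreover have "card (mg_edges G) > 0" using e finite_edges by (auto simp: card_gt_0_iff)
    ultimately show False using asm e finite_edges by simp
  qed
  then show "mg_tree G" using asm by (auto simp: mg_tree_def)
qed

section \<open>The number of spanning trees\<close>

lemma mg_loopless_edges_subset:
  "mg_loopless G \<Longrightarrow> T \<subseteq> mg_edges G \<Longrightarrow> mg_loopless (G\<lparr>mg_edges := T\<rparr>)"
  by (auto simp: mg_loopless_def)

text \<open>By \<open>tree_iff_card\<close>, a spanning tree has as many edges as the tree
  \<open>G\<close> itself, hence all of them.\<close>

lemma (in finite_multigraph) tau_tree:
  assumes tree: "mg_tree G" and loopless: "mg_loopless G"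
  shows "tau G = 1"
proof -
  have "T = mg_edges G" if T: "T \<in> spanning_trees G" for T
  proof -
    have sub: "T \<subseteq> mg_edges G" and tr: "mg_tree (G\<lparr>mg_edges := T\<rparr>)"
      using T by (auto simp: spanning_trees_def)
    interpret T: finite_multigraph "G\<lparr>mg_edges := T\<rparr>"
      using finite_multigraph_axioms sub by (rule finite_multigraph_edges_subset)
    have "card T = card (mg_edges G)"
      using T.tree_iff_card[OF mg_loopless_edges_subset[OF loopless sub]] tr
        tree_iff_card[OF loopless] tree by simp
    then show ?thesis using sub finite_edges by (simp add: card_subset_eq)
  qed
  moreover have "mg_edges G \<in> spanning_trees G" using tree by (simp add: spanning_trees_def)
  ultimately have "spanning_trees G = {mg_edges G}" by blast
  then show ?thesis by (simp add: tau_def)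
qed

lemma (in finite_multigraph) finite_spanning_trees: "finite (spanning_trees G)"
  by (rule finite_subset[of _ "Pow (mg_edges G)"]) (auto simp: spanning_trees_def finite_edges)

section \<open>Upper bound: product of degrees and AM-GM\<close>

lemma (in finite_multigraph) tau_le_prod_degrees:
  assumes r: "r \<in> mg_verts G" and loopless: "mg_loopless G"
  shows "tau G \<le> (\<Prod>v\<in>mg_verts G - {r}. card {e \<in> mg_edges G. v \<in> mg_ends G e})"
proof -
  let ?V = "mg_verts G - {r}" and ?I = "\<lambda>v. {e \<in> mg_edges G. v \<in> mg_ends G e}"
  have ex: "\<exists>p. p \<in> Pi\<^sub>E ?V ?I \<and> T = p ` ?V" if T: "T \<in> spanning_trees G" for T
  proof -
    have sub: "T \<subseteq> mg_edges G" and tr: "mg_tree (G\<lparr>mg_edges := T\<rparr>)"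
      using T by (auto simp: spanning_trees_def)
    interpret T: finite_multigraph "G\<lparr>mg_edges := T\<rparr>"
      using finite_multigraph_axioms sub by (rule finite_multigraph_edges_subset)
    have "r \<in> mg_verts (G\<lparr>mg_edges := T\<rparr>)" using r by simp
    from T.tree_parent_edges[OF tr this mg_loopless_edges_subset[OF loopless sub]]
    obtain p where p: "T = p ` ?V" "\<And>v. v \<in> ?V \<Longrightarrow> v \<in> mg_ends G (p v)"
      by simp blast
    \<comment> \<open>Restriction to \<open>?V\<close> puts the parent function into the extensional
      product, whose cardinality is the product of the degrees.\<close>
    have "restrict p ?V \<in> Pi\<^sub>E ?V ?I" using p sub by auto
    moreover have "T = restrict p ?V ` ?V" using p(1) by simp
    ultimately show ?thesis by blast
  qed
  \<comment> \<open>Choosing an incident edge at each non-root vertex therefore reaches every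
    spanning tree, and possibly other edge sets.\<close>
  have "spanning_trees G \<subseteq> (\<lambda>p. p ` ?V) ` Pi\<^sub>E ?V ?I" using ex by blast
  moreover have fin: "finite (Pi\<^sub>E ?V ?I)"
    using finite_verts finite_edges by (intro finite_PiE) auto
  ultimately have "card (spanning_trees G) \<le> card (Pi\<^sub>E ?V ?I)" by (rule surj_card_le[rotated])
  then show ?thesis using finite_verts by (simp add: tau_def card_PiE)
qed

text \<open>The handshake lemma, by double counting incidences.\<close>

lemma (in finite_multigraph) sum_degrees:
  assumes "mg_loopless G"
  shows "(\<Sum>v\<in>mg_verts G. card {e \<in> mg_edges G. v \<in> mg_ends G e}) = 2 * card (mg_edges G)"
proof -
  have "(\<Sum>v\<in>mg_verts G. card {e \<in> mg_edges G. v \<in> mg_ends G e}) =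
      (\<Sum>e\<in>mg_edges G. card {v \<in> mg_verts G. v \<in> mg_ends G e})"
    using finite_verts finite_edges by (rule sum_multicount_gen) auto
  also have "\<dots> = (\<Sum>e\<in>mg_edges G. 2)"
  proof (rule sum.cong)
    fix e assume e: "e \<in> mg_edges G"
    then have "{v \<in> mg_verts G. v \<in> mg_ends G e} = mg_ends G e" using ends_subset by blast
    then show "card {v \<in> mg_verts G. v \<in> mg_ends G e} = 2" using e assms by (simp add: mg_loopless_def)
  qed simp
  finally show ?thesis by simp
qed

text \<open>AM-GM in logarithmic form, with an upper bound \<open>s\<close> in place of the
  sum.\<close>

lemma sum_ln_le_mean:
  fixes x :: "'b \<Rightarrow> real"
  assumes A: "finite A" "A \<noteq> {}" and pos: "\<And>a. a \<in> A \<Longrightarrow> x a > 0" and s: "sum x A \<le> s"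
  shows "(\<Sum>a\<in>A. ln (x a)) \<le> card A * ln (s / card A)"
proof -
  define c where "c = s / card A"
  have n: "real (card A) > 0" using A by (simp add: card_gt_0_iff)
  have "sum x A > 0" using A pos by (intro sum_pos)
  then have c: "c > 0" "s = c * card A" using n s by (auto simp: c_def)
  \<comment> \<open>The tangent bound \<open>ln t <= t - 1\<close> at \<open>t = x a / c\<close>,
    where \<open>c\<close> is the bound on the mean. The terms \<open>x a / c\<close> then add up to
    at most \<open>card A\<close>.\<close>
  have "(\<Sum>a\<in>A. ln (x a)) \<le> (\<Sum>a\<in>A. x a / c - 1 + ln c)"
  proof (rule sum_mono)
    fix a assume "a \<in> A"
    then have "ln (x a / c) \<le> x a / c - 1" using pos c by (intro ln_le_minus_one) auto
    then show "ln (x a) \<le> x a / c - 1 + ln c" using pos[OF \<open>a \<in> A\<close>] c by (simp add: ln_div)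
  qed
  also have "\<dots> = sum x A / c - card A + card A * ln c"
    by (simp add: sum.distrib sum_subtractf sum_divide_distrib)
  also have "sum x A / c \<le> card A" using s c by (simp add: field_simps)
  finally show ?thesis by (simp add: c_def)
qed

lemma (in finite_multigraph) ln_tau_le:
  assumes loopless: "mg_loopless G" and tau: "tau G > 0" and card: "card (mg_verts G) > 1"
  shows "ln (tau G) \<le> (real (card (mg_verts G)) - 1)
           * ln (2 * real (card (mg_edges G)) / (real (card (mg_verts G)) - 1))"
proof -
  obtain r where r: "r \<in> mg_verts G" using card by fastforce
  let ?V = "mg_verts G - {r}" and ?d = "\<lambda>v. card {e \<in> mg_edges G. v \<in> mg_ends G e}"
  have cV: "card ?V = card (mg_verts G) - 1" "finite ?V" "real (card ?V) = real (card (mg_verts G)) - 1"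
    using r finite_verts card by (auto simp: of_nat_diff)
  then have ne: "?V \<noteq> {}" using card by force
  note le = tau_le_prod_degrees[OF r loopless]
  \<comment> \<open>A positive \<open>tau G\<close> makes every degree in the product positive, as
    the logarithms require.\<close>
  then have "0 < prod ?d ?V" using tau by linarith
  then have pos: "?d v > 0" if "v \<in> ?V" for v
    using that prod_zero[OF cV(2), of ?d] by (cases "?d v = 0") auto
  have "real (tau G) \<le> (\<Prod>v\<in>?V. real (?d v))" using le by (simp flip: of_nat_prod)
  then have "ln (tau G) \<le> ln (\<Prod>v\<in>?V. real (?d v))" using tau by simp
  also have "\<dots> = (\<Sum>v\<in>?V. ln (real (?d v)))"
    using pos finite_verts by (subst ln_prod) auto
  also have "\<dots> \<le> card ?V * ln ((2 * real (card (mg_edges G))) / card ?V)"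
  proof (rule sum_ln_le_mean[OF cV(2) ne])
    \<comment> \<open>Adding the degree of the root only enlarges the sum, which the handshake lemma
      then evaluates.\<close>
    have "(\<Sum>v\<in>?V. ?d v) \<le> (\<Sum>v\<in>mg_verts G. ?d v)" using finite_verts by (intro sum_mono2) auto
    then have "(\<Sum>v\<in>?V. ?d v) \<le> 2 * card (mg_edges G)" using sum_degrees[OF loopless] by simp
    then have "real (\<Sum>v\<in>?V. ?d v) \<le> real (2 * card (mg_edges G))" using of_nat_mono by blast
    then show "(\<Sum>v\<in>?V. real (?d v)) \<le> 2 * real (card (mg_edges G))" by simp
  qed (use pos in auto)
  finally show ?thesis using cV by simp
qed

section \<open>Lower bound: growing an induced subgraph\<close>

definition induced_subgraph :: "('v, 'e) multigraph \<Rightarrow> 'v set \<Rightarrow> ('v, 'e) multigraph" where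
  "induced_subgraph G S = G\<lparr>mg_verts := S, mg_edges := {e \<in> mg_edges G. mg_ends G e \<subseteq> S}\<rparr>"

lemma (in finite_multigraph) finite_multigraph_induced:
  "S \<subseteq> mg_verts G \<Longrightarrow> finite_multigraph (induced_subgraph G S)"
  using finite_verts finite_edges
  by (auto simp: finite_multigraph_def induced_subgraph_def intro: finite_subset)

lemma mg_loopless_induced: "mg_loopless G \<Longrightarrow> mg_loopless (induced_subgraph G S)"
  by (auto simp: mg_loopless_def induced_subgraph_def)

lemma (in finite_multigraph) induced_subgraph_self: "induced_subgraph G (mg_verts G) = G"
proof -
  have "{e \<in> mg_edges G. mg_ends G e \<subseteq> mg_verts G} = mg_edges G" using ends_subset by blast
  then show ?thesis by (simp add: induced_subgraph_def)
qed

text \<open>The leaf adds one vertex and one edge, so the count in \<open>tree_iff_card\<close> is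
  preserved. That \<open>e\<close> is new makes the extension maps injective in the two lemmas on
  \<open>tau\<close> below.\<close>

lemma (in finite_multigraph) spanning_tree_insert_leaf:
  assumes loopless: "mg_loopless G" and S: "S \<subseteq> mg_verts G"
    and T: "T \<in> spanning_trees (induced_subgraph G S)"
    and e: "e \<in> mg_edges G" "mg_ends G e = {u, x}" "u \<in> S" "x \<notin> S"
  shows "insert e T \<in> spanning_trees (induced_subgraph G (insert x S))"
    and "e \<notin> T"
proof -
  let ?A = "induced_subgraph G S" and ?B = "induced_subgraph G (insert x S)"
  have "x \<in> mg_verts G" using ends_subset[OF e(1)] e(2) by auto
  then have wf: "finite_multigraph ?A" "finite_multigraph ?B"
    using S by (auto intro!: finite_multigraph_induced)
  have TA: "T \<subseteq> mg_edges ?A" and tr: "mg_tree (?A\<lparr>mg_edges := T\<rparr>)"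
    using T by (auto simp: spanning_trees_def)
  show eT: "e \<notin> T" using TA e by (auto simp: induced_subgraph_def)
  have TB: "insert e T \<subseteq> mg_edges ?B" using TA e by (auto simp: induced_subgraph_def)
  interpret A: finite_multigraph "?A\<lparr>mg_edges := T\<rparr>"
    using wf(1) TA by (rule finite_multigraph_edges_subset)
  interpret B: finite_multigraph "?B\<lparr>mg_edges := insert e T\<rparr>"
    using wf(2) TB by (rule finite_multigraph_edges_subset)
  have A: "mg_connected (?A\<lparr>mg_edges := T\<rparr>)" "card S = Suc (card T)"
    using tr A.tree_iff_card[OF mg_loopless_edges_subset[OF mg_loopless_induced[OF loopless] TA]]
    by (auto simp: induced_subgraph_def)
  have "finite T" "finite S" using A.finite_edges A.finite_verts by (auto simp: induced_subgraph_def)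
  then have card: "card (insert x S) = Suc (card (insert e T))" using A(2) e eT by simp
  have adj: "mg_adj (?A\<lparr>mg_edges := T\<rparr>) \<subseteq> mg_adj (?B\<lparr>mg_edges := insert e T\<rparr>)"
    by (auto simp: mg_adj_def induced_subgraph_def)
  have "mg_connected (?B\<lparr>mg_edges := insert e T\<rparr>)"
  proof (rule mg_connectedI_root[of u])
    fix v assume v: "v \<in> mg_verts (?B\<lparr>mg_edges := insert e T\<rparr>)"
    show "(u, v) \<in> (mg_adj (?B\<lparr>mg_edges := insert e T\<rparr>))\<^sup>*"
    proof (cases "v = x")
      case True
      then have "(u, v) \<in> mg_adj (?B\<lparr>mg_edges := insert e T\<rparr>)"
        using e by (auto simp: mg_adj_def induced_subgraph_def)
      then show ?thesis by auto
    next
      case False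
      then have "(u, v) \<in> (mg_adj (?A\<lparr>mg_edges := T\<rparr>))\<^sup>*"
        using A(1) v e by (auto simp: mg_connected_def induced_subgraph_def)
      then show ?thesis using rtrancl_mono[OF adj] by blast
    qed
  qed (use e in \<open>auto simp: induced_subgraph_def\<close>)
  then have "mg_tree (?B\<lparr>mg_edges := insert e T\<rparr>)"
    using card B.tree_iff_card[OF mg_loopless_edges_subset[OF mg_loopless_induced[OF loopless] TB]]
    by (simp add: induced_subgraph_def)
  then show "insert e T \<in> spanning_trees ?B" using TB by (simp add: spanning_trees_def)
qed

text \<open>Here \<open>A\<close> will be the trees to extend, \<open>B\<close> the extended trees,
  and \<open>I\<close> the possible choices of new edges.\<close>

lemma card_ge_of_disjoint_images:
  assumes "finite B" "finite I" "\<And>i. i \<in> I \<Longrightarrow> inj_on (g i) A" "\<And>i. i \<in> I \<Longrightarrow> g i ` A \<subseteq> B"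
    and "\<And>i j. i \<in> I \<Longrightarrow> j \<in> I \<Longrightarrow> i \<noteq> j \<Longrightarrow> g i ` A \<inter> g j ` A = {}"
  shows "card I * card A \<le> card B"
proof -
  have "card I * card A = (\<Sum>i\<in>I. card (g i ` A))" using assms(3) by (simp add: card_image)
  also have "\<dots> = card (\<Union>i\<in>I. g i ` A)"
    using assms by (intro card_UN_disjoint[symmetric]) (auto dest: finite_subset)
  also have "\<dots> \<le> card B" using assms by (intro card_mono) auto
  finally show ?thesis .
qed

text \<open>Either edge attaches \<open>x\<close> as a leaf, and the extended tree shows which one
  was used. The edges differ because \<open>u\<close> and \<open>u'\<close> do.\<close>

lemma (in finite_multigraph) tau_induced_insert:
  assumes loopless: "mg_loopless G" and S: "S \<subseteq> mg_verts G"
    and e: "e \<in> mg_edges G" "mg_ends G e = {u, x}" "u \<in> S"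
    and e': "e' \<in> mg_edges G" "mg_ends G e' = {u', x}" "u' \<in> S"
    and ne: "u \<noteq> u'" and x: "x \<in> mg_verts G - S"
  shows "2 * tau (induced_subgraph G S) \<le> tau (induced_subgraph G (insert x S))"
proof -
  let ?A = "spanning_trees (induced_subgraph G S)"
    and ?B = "spanning_trees (induced_subgraph G (insert x S))"
  have ee: "e \<noteq> e'" using e e' ne x by (auto simp: doubleton_eq_iff)
  have new: "insert d T \<in> ?B" "d \<notin> T" if "T \<in> ?A" "d \<in> {e, e'}" for T d
    using spanning_tree_insert_leaf[OF loopless S that(1)] that(2) e e' x by auto
  have "finite ?B" using S x
    by (intro finite_multigraph.finite_spanning_trees finite_multigraph_induced) auto
  then have "card {e, e'} * card ?A \<le> card ?B"
  proof (rule card_ge_of_disjoint_images[where g = insert])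
    show "inj_on (insert d) ?A" if "d \<in> {e, e'}" for d
      using new(2)[OF _ that] by (intro inj_onI) (metis insert_ident)
    show "insert d ` ?A \<inter> insert d' ` ?A = {}" if "d \<in> {e, e'}" "d' \<in> {e, e'}" "d \<noteq> d'" for d d'
    proof -
      have "d \<notin> T" "d' \<notin> T" if "T \<in> ?A" for T
        using new(2)[OF that] \<open>d \<in> {e, e'}\<close> \<open>d' \<in> {e, e'}\<close> by auto
      then show ?thesis using \<open>d \<noteq> d'\<close> by blast
    qed
  qed (use new in auto)
  then show ?thesis using ee by (simp add: tau_def)
qed

text \<open>Any two of the three edges of the triangle \<open>u\<close>, \<open>x\<close>,
  \<open>y\<close> attach both new vertices.\<close>

lemma (in finite_multigraph) tau_induced_insert2:
  assumes loopless: "mg_loopless G" and S: "S \<subseteq> mg_verts G"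
    and e1: "e1 \<in> mg_edges G" "mg_ends G e1 = {u, x}"
    and e2: "e2 \<in> mg_edges G" "mg_ends G e2 = {u, y}"
    and e3: "e3 \<in> mg_edges G" "mg_ends G e3 = {x, y}"
    and u: "u \<in> S" and xy: "x \<in> mg_verts G - S" "y \<in> mg_verts G - S" "x \<noteq> y"
  shows "3 * tau (induced_subgraph G S) \<le> tau (induced_subgraph G (insert x (insert y S)))"
proof -
  let ?A = "spanning_trees (induced_subgraph G S)"
    and ?B = "spanning_trees (induced_subgraph G (insert x (insert y S)))"
  let ?I = "{{e1, e2}, {e1, e3}, {e2, e3}}"
  have ee: "e1 \<noteq> e2" "e1 \<noteq> e3" "e2 \<noteq> e3" using e1 e2 e3 u xy by (auto simp: doubleton_eq_iff)
  have sub: "insert x S \<subseteq> mg_verts G" "insert y S \<subseteq> mg_verts G" using S xy by auto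
  have disj: "T \<inter> {e1, e2, e3} = {}" if "T \<in> ?A" for T
    using that e1 e2 e3 xy by (auto simp: spanning_trees_def induced_subgraph_def)
  have e3': "mg_ends G e3 = {y, x}" using e3 by auto
  have "{e1, e2} \<union> T \<in> ?B \<and> {e1, e3} \<union> T \<in> ?B \<and> {e2, e3} \<union> T \<in> ?B" if T: "T \<in> ?A" for T
  proof -
    \<comment> \<open>Each pair is added as two leaves in turn: \<open>x\<close> comes first for the
      pairs containing \<open>e1\<close>, and \<open>y\<close> for the pair \<open>e2\<close>,
      \<open>e3\<close>.\<close>
    have 1: "insert e1 T \<in> spanning_trees (induced_subgraph G (insert x S))"
      using spanning_tree_insert_leaf(1)[OF loopless S T e1 u] xy by auto
    have 2: "insert e2 T \<in> spanning_trees (induced_subgraph G (insert y S))"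
      using spanning_tree_insert_leaf(1)[OF loopless S T e2 u] xy by auto
    have "insert e2 (insert e1 T) \<in> spanning_trees (induced_subgraph G (insert y (insert x S)))"
      using spanning_tree_insert_leaf(1)[OF loopless sub(1) 1 e2] u xy by auto
    moreover have "insert e3 (insert e1 T) \<in> spanning_trees (induced_subgraph G (insert y (insert x S)))"
      using spanning_tree_insert_leaf(1)[OF loopless sub(1) 1 e3] u xy by auto
    moreover have "insert e3 (insert e2 T) \<in> ?B"
      using spanning_tree_insert_leaf(1)[OF loopless sub(2) 2 e3(1) e3'] u xy by auto
    ultimately show ?thesis by (simp add: insert_commute)
  qed
  then have new: "D \<union> T \<in> ?B" if "D \<in> ?I" "T \<in> ?A" for D T using that by auto
  have "finite ?B" using S xy
    by (intro finite_multigraph.finite_spanning_trees finite_multigraph_induced) auto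
  then have "card ?I * card ?A \<le> card ?B"
  proof (rule card_ge_of_disjoint_images[where g = "(\<union>)"])
    show "inj_on ((\<union>) D) ?A" if "D \<in> ?I" for D
    proof (rule inj_onI)
      fix T T' assume T: "T \<in> ?A" "T' \<in> ?A" "D \<union> T = D \<union> T'"
      have "D \<inter> T = {}" "D \<inter> T' = {}" using disj[OF T(1)] disj[OF T(2)] that by auto
      then show "T = T'" using T(3) by blast
    qed
    show "(\<union>) D ` ?A \<inter> (\<union>) D' ` ?A = {}" if "D \<in> ?I" "D' \<in> ?I" "D \<noteq> D'" for D D'
    proof -
      have "D \<union> T \<noteq> D' \<union> T'" if T: "T \<in> ?A" "T' \<in> ?A" for T T'
      proof
        assume "D \<union> T = D' \<union> T'"
        \<comment> \<open>Old trees avoid the triangle, so intersecting with its edges recovers the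
          chosen pair.\<close>
        then have "(D \<union> T) \<inter> {e1, e2, e3} = (D' \<union> T') \<inter> {e1, e2, e3}" by simp
        then have "D \<inter> {e1, e2, e3} = D' \<inter> {e1, e2, e3}"
          using disj[OF T(1)] disj[OF T(2)] by blast
        moreover have "D \<subseteq> {e1, e2, e3}" "D' \<subseteq> {e1, e2, e3}"
          using \<open>D \<in> ?I\<close> \<open>D' \<in> ?I\<close> by auto
        ultimately show False using \<open>D \<noteq> D'\<close> by (simp add: Int_absorb2)
      qed
      then show ?thesis by blast
    qed
  qed (use new in auto)
  moreover have "card ?I = 3" using ee by (auto simp: doubleton_eq_iff card_insert_if)
  ultimately show ?thesis by (simp add: tau_def)
qed

lemma connected_edge_boundary:
  assumes "mg_connected G" "S \<subseteq> mg_verts G" "S \<noteq> {}" "S \<noteq> mg_verts G"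
  obtains e u v where "e \<in> mg_edges G" "mg_ends G e = {u, v}" "u \<in> S" "v \<notin> S"
proof -
  obtain a b where ab: "a \<in> S" "b \<in> mg_verts G" "b \<notin> S" using assms(2-4) by blast
  then have "(a, b) \<in> (mg_adj G)\<^sup>*" using assms by (auto simp: mg_connected_def)
  then have "\<exists>u v. (u, v) \<in> mg_adj G \<and> u \<in> S \<and> v \<notin> S"
    using ab(1,3) by (induction rule: rtrancl_induct) blast+
  then show thesis using that by (auto simp: mg_adj_def)
qed

text \<open>Each new vertex must gain a factor \<open>sqrt 3\<close>: one vertex gains
  \<open>2 >= sqrt 3\<close>, and two vertices together gain \<open>3\<close>, the square of
  \<open>sqrt 3\<close>. A maximal vertex set satisfying the bound is thus the whole vertex
  set.\<close>

lemma (in finite_multigraph) tau_ge_sqrt3_power: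
  assumes conn: "mg_connected G" and loopless: "mg_loopless G"
    and triangle: "\<And>e. e \<in> mg_edges G \<Longrightarrow>
      \<exists>x y z e' e''. distinct [x, y, z] \<and> mg_ends G e = {x, y} \<and>
        e' \<in> mg_edges G \<and> mg_ends G e' = {x, z} \<and> e'' \<in> mg_edges G \<and> mg_ends G e'' = {y, z}"
  shows "sqrt 3 ^ (card (mg_verts G) - 1) \<le> tau G"
proof -
  let ?t = "\<lambda>S. real (tau (induced_subgraph G S))"
  define F where "F = {S. S \<subseteq> mg_verts G \<and> S \<noteq> {} \<and> sqrt 3 ^ (card S - 1) \<le> ?t S}"
  obtain r where r: "r \<in> mg_verts G" using conn by (auto simp: mg_connected_def)
  \<comment> \<open>Without loops a single vertex carries no edge, so its graph is a tree and the
    bound reads \<open>1 <= 1\<close>.\<close>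
  have "{r} \<in> F"
  proof -
    let ?H = "induced_subgraph G {r}"
    interpret H: finite_multigraph ?H using r by (intro finite_multigraph_induced) auto
    have "card (mg_ends G e) \<noteq> 2" if "mg_ends G e \<subseteq> {r}" for e
      using card_mono[OF _ that] by auto
    then have "mg_edges ?H = {}" using loopless by (auto simp: induced_subgraph_def mg_loopless_def)
    moreover have "mg_verts ?H = {r}" by (simp add: induced_subgraph_def)
    moreover have "mg_connected ?H" by (auto simp: mg_connected_def induced_subgraph_def)
    ultimately have "mg_tree ?H" using H.tree_iff_card[OF mg_loopless_induced[OF loopless]] by simp
    then have "tau ?H = 1" by (rule H.tau_tree[OF _ mg_loopless_induced[OF loopless]])
    then show ?thesis using r by (simp add: F_def)
  qed
  moreover have "finite F"
    by (rule finite_subset[of _ "Pow (mg_verts G)"]) (auto simp: F_def finite_verts)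
  ultimately obtain S where S: "S \<in> F" and max: "\<And>S'. S' \<in> F \<Longrightarrow> S \<subseteq> S' \<Longrightarrow> S' = S"
    using finite_has_maximal[of F] by blast
  have SV: "S \<subseteq> mg_verts G" "S \<noteq> {}" "sqrt 3 ^ (card S - 1) \<le> ?t S" using S by (auto simp: F_def)
  have finS: "finite S" using SV finite_verts finite_subset by blast
  then have cS: "card S > 0" using SV by (simp add: card_gt_0_iff)
  have s3: "sqrt 3 \<le> 2" by (rule real_le_lsqrt) auto
  have "S = mg_verts G"
  proof (rule ccontr)
    assume "S \<noteq> mg_verts G"
    then obtain e u v where e: "e \<in> mg_edges G" "mg_ends G e = {u, v}" "u \<in> S" "v \<notin> S"
      using connected_edge_boundary[OF conn SV(1,2)] by metis
    obtain x y z e1 e2 where *: "distinct [x, y, z]" "mg_ends G e = {x, y}"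
      "e1 \<in> mg_edges G" "mg_ends G e1 = {x, z}" "e2 \<in> mg_edges G" "mg_ends G e2 = {y, z}"
      using triangle[OF e(1)] by blast
    \<comment> \<open>The triangle lists the ends of \<open>e\<close> in an unknown order; here they
      are matched with \<open>u\<close> inside and \<open>v\<close> outside
      \<open>S\<close>.\<close>
    have "\<exists>e' e''. z \<noteq> u \<and> z \<noteq> v \<and> e' \<in> mg_edges G \<and> mg_ends G e' = {u, z} \<and>
        e'' \<in> mg_edges G \<and> mg_ends G e'' = {v, z}"
    proof (cases "x = u")
      case True
      then show ?thesis using * e by (auto simp: doubleton_eq_iff)
    next
      case False
      then have "x = v" "y = u" using * e by (auto simp: doubleton_eq_iff)
      then show ?thesis using * by auto
    qed
    then obtain e' e'' where z: "z \<noteq> u" "z \<noteq> v" "e' \<in> mg_edges G" "mg_ends G e' = {u, z}"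
      "e'' \<in> mg_edges G" "mg_ends G e'' = {v, z}" by blast
    have V: "v \<in> mg_verts G" "z \<in> mg_verts G"
      using ends_subset[OF e(1)] ends_subset[OF z(3)] e z by auto
    show False
    proof (cases "z \<in> S")
      case True
      have "2 * tau (induced_subgraph G S) \<le> tau (induced_subgraph G (insert v S))"
        by (rule tau_induced_insert[OF loopless SV(1) e(1-3) z(5) _ True])
          (use z e V in auto)
      then have "2 * ?t S \<le> ?t (insert v S)" by linarith
      moreover have "sqrt 3 * sqrt 3 ^ (card S - 1) \<le> 2 * ?t S"
        using s3 SV(3) by (intro mult_mono) auto
      moreover have "sqrt 3 ^ (card (insert v S) - 1) = sqrt 3 * sqrt 3 ^ (card S - 1)"
        using cS finS e by (simp flip: power_Suc)
      ultimately have "insert v S \<in> F" using V SV by (auto simp: F_def)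
      then show False using max[of "insert v S"] e by auto
    next
      case False
      have "3 * tau (induced_subgraph G S) \<le> tau (induced_subgraph G (insert v (insert z S)))"
        by (rule tau_induced_insert2[OF loopless SV(1) e(1,2) z(3-6) e(3)])
          (use z e V False in auto)
      then have "3 * ?t S \<le> ?t (insert v (insert z S))" by linarith
      moreover have "sqrt 3 ^ (card (insert v (insert z S)) - 1) = sqrt 3 ^ Suc (Suc (card S - 1))"
        using cS finS e z False by simp
      then have "sqrt 3 ^ (card (insert v (insert z S)) - 1) = 3 * sqrt 3 ^ (card S - 1)"
        by simp
      ultimately have "insert v (insert z S) \<in> F" using V SV by (auto simp: F_def)
      then show False using max[of "insert v (insert z S)"] e by auto
    qed
  qed
  then show ?thesis using SV(3) induced_subgraph_self by simp
qed

section \<open>Counting vertices and edges of the approximating graphs\<close>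

text \<open>Two points realising the diameter have preimages in \<open>S\<close>, so the diameter is
  at most \<open>c < 1\<close> times itself.\<close>

lemma contraction_self_image_singleton:
  assumes g: "injective_contraction g" and S: "compact S" "S \<subseteq> g ` S" and xy: "x \<in> S" "y \<in> S"
  shows "x = y"
proof -
  obtain c where c: "c < 1" "c-lipschitz_on UNIV g" using g by (auto simp: injective_contraction_def)
  obtain a b where ab: "a \<in> S" "b \<in> S" "dist a b = diameter S"
    using diameter_compact_attained[OF S(1)] xy by blast
  then obtain a' b' where ab': "a' \<in> S" "b' \<in> S" "a = g a'" "b = g b'" using S(2) by blast
  have le: "dist u v \<le> diameter S" if "u \<in> S" "v \<in> S" for u v
    using diameter_bounded_bound[OF compact_imp_bounded[OF S(1)]] that by blast
  have "diameter S \<le> c * dist a' b'" using lipschitz_onD[OF c(2), of a' b'] ab(3) ab' by simp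
  also have "\<dots> \<le> c * diameter S"
    using le[OF ab'(1,2)] c(2) by (intro mult_left_mono) (auto simp: lipschitz_on_def)
  finally have "(1 - c) * diameter S \<le> 0" by (simp add: algebra_simps)
  then have "diameter S \<le> 0" using c(1) by (simp add: mult_le_0_iff)
  then have "dist x y \<le> 0" using le[OF xy] by linarith
  then show ?thesis by simp
qed

lemma finite_words: "finite (words m n)"
  unfolding words_def by (rule finite_lists_length_eq) auto

lemma card_words: "card (words m n) = m ^ n"
  unfolding words_def using card_lists_length_eq[of "{1..m}" n] by simp

lemma words_0: "words m 0 = {[]}"
  by (auto simp: words_def)

lemma words_Suc: "words m (Suc n) = (\<Union>i\<in>{1..m}. (#) i ` words m n)"
  by (auto simp: words_def length_Suc_conv image_iff)

text \<open>Stated for any \<open>A\<close>, to serve both the cells of \<open>K\<close> and the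
  vertex sets.\<close>

lemma UN_words_Suc:
  "(\<Union>w\<in>words m (Suc n). word_map f w ` A) = (\<Union>i\<in>{1..m}. f i ` (\<Union>w\<in>words m n. word_map f w ` A))"
  by (auto simp: words_Suc image_UN image_image)

section \<open>Cells, glued points and the recurrence for the number of vertices\<close>

locale boundary_cells =
  fixes m :: nat and f :: "nat \<Rightarrow> 'a::metric_space \<Rightarrow> 'a" and K V0 :: "'a set"
  assumes contr: "i \<in> {1..m} \<Longrightarrow> injective_contraction (f i)"
    and self_similar: "self_similar_set m f K"
    and boundary: "boundary_set m f K V0"
begin

abbreviation "V \<equiv> approx_verts m f V0"

lemma inj_f: "i \<in> {1..m} \<Longrightarrow> inj (f i)"
  using contr by (auto simp: injective_contraction_def)

lemma finite_V0: "finite V0" and V0_subset: "V0 \<subseteq> K"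
  using boundary by (auto simp: boundary_set_def)

lemma K_eq: "K = (\<Union>i\<in>{1..m}. f i ` K)"
  using self_similar by (simp add: self_similar_set_def)

lemma K_eq_words: "K = (\<Union>w\<in>words m n. word_map f w ` K)"
proof (induction n)
  case (Suc n)
  then show ?case using K_eq by (simp only: UN_words_Suc flip: Suc)
qed (simp add: words_0)

lemma approx_verts_0: "V 0 = V0"
  by (simp add: approx_verts_def words_0)

lemma approx_verts_Suc: "V (Suc n) = (\<Union>i\<in>{1..m}. f i ` V n)"
  by (simp only: approx_verts_def UN_words_Suc)

lemma finite_V: "finite (V n)"
  unfolding approx_verts_def using finite_words finite_V0 by auto

lemma V_subset: "V n \<subseteq> K"
proof (induction n)
  case (Suc n)
  then show ?case unfolding approx_verts_Suc by (subst K_eq) blast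
qed (simp add: approx_verts_0 V0_subset)

lemma cells_meet: "w \<in> words m n \<Longrightarrow> w' \<in> words m n \<Longrightarrow> w \<noteq> w' \<Longrightarrow>
    word_map f w ` K \<inter> word_map f w' ` K = word_map f w ` V0 \<inter> word_map f w' ` V0"
  using boundary by (auto simp: boundary_set_def cells_meet_in_def)

text \<open>The inclusion \<open>V0 \<subseteq> V 1\<close> can fail, but the glued points of \<open>V0\<close> satisfy it.\<close>

lemma glued_point_in_V:
  assumes ij: "i \<in> {1..m}" "j \<in> {1..m}" "i \<noteq> j" and x: "x \<in> K" "f i x \<in> f j ` K"
  shows "x \<in> V n"
proof -
  obtain y where y: "y \<in> K" "f i x = f j y" using x by blast
  obtain w w' where w: "w \<in> words m n" "x \<in> word_map f w ` K" "w' \<in> words m n" "y \<in> word_map f w' ` K"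
    using x(1) y(1) K_eq_words[of n] by blast
  \<comment> \<open>The level-\<open>n\<close> cells around \<open>x\<close> and \<open>y\<close>
    become distinct cells of level \<open>n + 1\<close> that meet at \<open>f i x\<close>, and such
    cells meet only in images of \<open>V0\<close>.\<close>
  have "i # w \<in> words m (Suc n)" "j # w' \<in> words m (Suc n)" using w ij by (auto simp: words_Suc)
  then have "word_map f (i # w) ` K \<inter> word_map f (j # w') ` K \<subseteq> word_map f (i # w) ` V0"
    using cells_meet[of "i # w" "Suc n" "j # w'"] ij(3) by blast
  moreover have "f i x \<in> word_map f (i # w) ` K" using w(2) by auto
  moreover have "f i x \<in> word_map f (j # w') ` K" unfolding y(2) using w(4) by auto
  ultimately have "f i x \<in> f i ` (word_map f w ` V0)" by (auto simp: image_comp)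
  then have "x \<in> word_map f w ` V0" using inj_f[OF ij(1)] by (auto dest: injD)
  then show ?thesis using w(1) by (auto simp: approx_verts_def)
qed

text \<open>Formed with \<open>K\<close> instead of some \<open>V n\<close>, so it is the same set
  at every level.\<close>

definition glued :: "'a set" where
  "glued = {y. \<exists>i\<in>{1..m}. \<exists>j\<in>{1..m}. i \<noteq> j \<and> y \<in> f i ` K \<and> y \<in> f j ` K}"

text \<open>The right side does not mention \<open>n\<close>, so each step of the construction glues
  the same points. By injectivity a glued point of cell \<open>i\<close> has only one preimage, and
  \<open>glued_point_in_V\<close> places that preimage in \<open>V n\<close>.\<close>

lemma glued_inter_cell:
  assumes i: "i \<in> {1..m}"
  shows "f i ` V n \<inter> glued = f i ` K \<inter> glued"
proof -
  have "y \<in> f i ` V n" if y: "y \<in> f i ` K" "y \<in> glued" for y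
  proof -
    obtain a b where ab: "a \<in> {1..m}" "b \<in> {1..m}" "a \<noteq> b" "y \<in> f a ` K" "y \<in> f b ` K"
      using y(2) unfolding glued_def by blast
    \<comment> \<open>At least one of the two cells \<open>a\<close>, \<open>b\<close> differs from
      \<open>i\<close>.\<close>
    then obtain j where j: "j \<in> {1..m}" "i \<noteq> j" "y \<in> f j ` K" by metis
    obtain x where x: "x \<in> K" "y = f i x" using y(1) by blast
    then show ?thesis using glued_point_in_V[OF i j(1,2), of x n] j(3) by simp
  qed
  then show ?thesis using V_subset by blast
qed

text \<open>Off \<open>glued\<close> the \<open>m\<close> copies of \<open>V n\<close> are disjoint;
  the glued points are counted once, separately.\<close>

lemma card_V_Suc_eq:
  "real (card (V (Suc n))) = real m * real (card (V n)) + real (card glued)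
     - (\<Sum>i\<in>{1..m}. real (card (f i ` K \<inter> glued)))"
proof -
  have sub: "glued \<subseteq> V (Suc n)"
  proof
    fix y assume y: "y \<in> glued"
    then obtain i where i: "i \<in> {1..m}" "y \<in> f i ` K" by (auto simp: glued_def)
    then show "y \<in> V (Suc n)" using glued_inter_cell[OF i(1), of n] y unfolding approx_verts_Suc by blast
  qed
  have part: "card (f i ` V n - glued) = real (card (V n)) - card (f i ` K \<inter> glued)" if i: "i \<in> {1..m}" for i
  proof -
    have "card (f i ` V n) = card (V n)" using inj_f[OF i] by (intro card_image) (auto intro: inj_on_subset)
    moreover have "card (f i ` V n) = card (f i ` V n - glued) + card (f i ` V n \<inter> glued)"
      using finite_V card_Int_Diff[of "f i ` V n" glued] by simp
    ultimately show ?thesis using glued_inter_cell[OF i, of n] by simp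
  qed
  have "card (V (Suc n) - glued) = card (\<Union>i\<in>{1..m}. f i ` V n - glued)"
    by (simp add: approx_verts_Suc)
  also have "\<dots> = (\<Sum>i\<in>{1..m}. card (f i ` V n - glued))"
  proof (rule card_UN_disjoint)
    show "\<forall>i\<in>{1..m}. \<forall>j\<in>{1..m}. i \<noteq> j \<longrightarrow> (f i ` V n - glued) \<inter> (f j ` V n - glued) = {}"
    proof (intro ballI impI)
      fix i j assume ij: "i \<in> {1..m}" "j \<in> {1..m}" "i \<noteq> j"
      have "f i ` V n \<subseteq> f i ` K" "f j ` V n \<subseteq> f j ` K"
        using V_subset[of n] by (simp_all add: image_mono)
      moreover have "f i ` K \<inter> f j ` K \<subseteq> glued" using ij unfolding glued_def by blast
      ultimately show "(f i ` V n - glued) \<inter> (f j ` V n - glued) = {}" by blast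
    qed
  qed (auto simp: finite_V)
  finally have "real (card (V (Suc n) - glued))
      = (\<Sum>i\<in>{1..m}. real (card (V n)) - card (f i ` K \<inter> glued))"
    using part by (simp add: of_nat_sum)
  moreover have "card (V (Suc n)) = card (V (Suc n) - glued) + card glued"
    using sub finite_V[of "Suc n"] by (metis card_Diff_subset card_mono finite_subset le_add_diff_inverse2)
  ultimately show ?thesis by (simp add: sum_subtractf)
qed

text \<open>The gluing terms do not depend on \<open>n\<close>, so subtracting the case
  \<open>n = 0\<close> cancels them.\<close>

lemma card_V_Suc:
  "real (card (V (Suc n))) = real m * (real (card (V n)) - real (card V0)) + real (card (V 1))"
  using card_V_Suc_eq[of n] card_V_Suc_eq[of 0] by (simp add: approx_verts_0 algebra_simps)

text \<open>The recurrence solved; keeping the factor \<open>real m - 1\<close> on the left avoids a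
  division.\<close>

lemma card_V:
  "(real m - 1) * real (card (V n))
     = (real (card (V 1)) - real (card V0)) * real m ^ n
       + (real m * real (card V0) - real (card (V 1)))"
proof (induction n)
  case (Suc n)
  have "(real m - 1) * real (card (V (Suc n)))
      = real m * ((real m - 1) * real (card (V n)))
        + (real m - 1) * (real (card (V 1)) - real m * real (card V0))"
    by (subst card_V_Suc) (simp add: algebra_simps)
  then show ?case by (subst (asm) Suc) (simp add: algebra_simps)
qed (simp add: approx_verts_0 algebra_simps)

lemma m_ge_2:
  assumes "card V0 \<ge> 2"
  shows "m \<ge> 2"
proof (rule ccontr)
  assume "\<not> m \<ge> 2"
  moreover have "m \<noteq> 0" using K_eq self_similar by (auto simp: self_similar_set_def)
  ultimately have m: "m = 1" by simp
  then have "K = f 1 ` K" using K_eq by simp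
  then have "x = y" if "x \<in> K" "y \<in> K" for x y
    using contraction_self_image_singleton[of "f 1" K] contr[of 1] m that self_similar
    by (auto simp: self_similar_set_def)
  then show False using assms V0_subset by (auto simp: numeral_2_eq_2 card_le_Suc_iff)
qed

lemma card_V1_gt:
  assumes V0: "card V0 \<ge> 2"
  shows "card (V 1) > card V0"
proof (rule ccontr)
  assume "\<not> card (V 1) > card V0"
  then have le: "card (V 1) \<le> card V0" by simp
  have m: "1 \<in> {1..m}" "2 \<in> {1..m}" using m_ge_2[OF V0] by auto
  have V1: "f i ` V0 = V 1" if i: "i \<in> {1..m}" for i
  proof (rule card_subset_eq)
    show sub: "f i ` V0 \<subseteq> V 1" using approx_verts_Suc[of 0] i by (auto simp: approx_verts_0)
    have "card (f i ` V0) = card V0" using inj_f[OF i] by (intro card_image) (auto intro: inj_on_subset)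
    then show "card (f i ` V0) = card (V 1)" using le card_mono[OF finite_V sub] by simp
  qed (rule finite_V)
  have "V0 \<subseteq> V 1"
  proof
    fix x assume x: "x \<in> V0"
    then have "f 1 x \<in> f 2 ` K" using V1[OF m(1)] V1[OF m(2)] V0_subset by blast
    then show "x \<in> V 1" using glued_point_in_V[OF m] x V0_subset by auto
  qed
  then have "V0 \<subseteq> f 1 ` V0" using V1[OF m(1)] by simp
  then have "x = y" if "x \<in> V0" "y \<in> V0" for x y
    using contraction_self_image_singleton[OF contr[OF m(1)]] finite_imp_compact[OF finite_V0] that by blast
  then show False using assms by (auto simp: numeral_2_eq_2 card_le_Suc_iff)
qed

section \<open>Edges and triangles of the approximating graphs\<close>

abbreviation "G \<equiv> approx_graph m f V0"

lemma mg_verts_G: "mg_verts (G n) = V n"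
  by (simp add: approx_graph_def)

lemma card_edges_G: "card (mg_edges (G n)) = m ^ n * (card V0 choose 2)"
  using n_subsets[OF finite_V0, of 2] by (simp add: approx_graph_def card_words card_cartesian_product)

lemma two_card_edges_G:
  "2 * real (card (mg_edges (G n))) = real m ^ n * (real (card V0) * (real (card V0) - 1))"
  unfolding card_edges_G
  by (cases "card V0") (auto simp: choose_two real_of_nat_div algebra_simps)

text \<open>A third point of \<open>V0\<close> completes the triangle within the same cell.
  Looplessness keeps the images of its corners apart.\<close>

lemma triangle_G:
  assumes loopless: "mg_loopless (G n)" and V0: "card V0 > 2" and e: "e \<in> mg_edges (G n)"
  shows "\<exists>x y z e' e''. distinct [x, y, z] \<and> mg_ends (G n) e = {x, y} \<and>
    e' \<in> mg_edges (G n) \<and> mg_ends (G n) e' = {x, z} \<and> e'' \<in> mg_edges (G n) \<and> mg_ends (G n) e'' = {y, z}"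
proof -
  obtain w s where ws: "e = (w, s)" "w \<in> words m n" "s \<subseteq> V0" "card s = 2"
    using e by (auto simp: approx_graph_def)
  obtain a b where ab: "s = {a, b}" "a \<noteq> b" using ws by (auto simp: card_2_iff)
  have "card (V0 - {a, b}) > 0" using V0 ws ab finite_V0 by (simp add: card_Diff_subset)
  then obtain c where c: "c \<in> V0" "c \<noteq> a" "c \<noteq> b" by (auto simp: card_gt_0_iff)
  let ?g = "word_map f w"
  have edge: "(w, {u, v}) \<in> mg_edges (G n) \<and> mg_ends (G n) (w, {u, v}) = {?g u, ?g v} \<and> ?g u \<noteq> ?g v"
    if "u \<in> V0" "v \<in> V0" "u \<noteq> v" for u v
  proof -
    have "(w, {u, v}) \<in> mg_edges (G n)" using ws(2) that by (auto simp: approx_graph_def)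
    moreover have "mg_ends (G n) (w, {u, v}) = {?g u, ?g v}" by (simp add: approx_graph_def)
    moreover have "card (mg_ends (G n) (w, {u, v})) = 2"
      using loopless calculation(1) by (auto simp: mg_loopless_def)
    ultimately show ?thesis by (auto simp: card_2_iff doubleton_eq_iff)
  qed
  have V: "a \<in> V0" "b \<in> V0" using ws ab by auto
  note E = edge[OF V ab(2)] edge[OF V(1) c(1) c(2)[symmetric]] edge[OF V(2) c(1) c(3)[symmetric]]
  show ?thesis
    by (intro exI[of _ "?g a"] exI[of _ "?g b"] exI[of _ "?g c"] exI[of _ "(w, {a, c})"] exI[of _ "(w, {b, c})"])
      (use E ws ab in simp)
qed

text \<open>Read off from \<open>card_V\<close>, because \<open>V0\<close> need not be contained in
  \<open>V n\<close>.\<close>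

lemma card_V_ge:
  assumes "card V0 \<ge> 2"
  shows "card (V n) \<ge> card V0"
proof -
  have m: "real m \<ge> 2" using m_ge_2[OF assms] by simp
  have "(real (card (V 1)) - real (card V0)) * 1 \<le> (real (card (V 1)) - real (card V0)) * real m ^ n"
    using card_V1_gt[OF assms] m by (intro mult_left_mono one_le_power) auto
  then have "(real m - 1) * real (card V0) \<le> (real m - 1) * real (card (V n))"
    unfolding card_V by (simp add: algebra_simps)
  then show ?thesis using m by simp
qed

end

section \<open>Limits of affine functions and their ratios\<close>

lemma filterlim_affine:
  fixes a b :: real
  assumes "a > 0"
  shows "filterlim (\<lambda>x. a * x + b) at_top at_top"
  using assms by real_asymp

lemma affine_div_tendsto: "((\<lambda>x :: real. (a * x + b) / x) \<longlongrightarrow> a) at_top"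
  by real_asymp

text \<open>For \<open>x = m ^ n\<close>, the term \<open>a * x + b\<close> will be the number of
  vertices of \<open>G n\<close> and \<open>c * x\<close> twice its number of edges.\<close>

lemma affine_ratio_tendsto:
  fixes a b c :: real
  assumes "a > 0" "c > 0"
  shows "((\<lambda>x. (a * x + b - 1) / (a * x + b) * ln (c * x / (a * x + b - 1))) \<longlongrightarrow> ln (c / a)) at_top"
proof -
  have "((\<lambda>x. (a * x + b - 1) / (a * x + b)) \<longlongrightarrow> 1) at_top" using assms by (real_asymp simp: field_simps)
  moreover have "((\<lambda>x. c * x / (a * x + b - 1)) \<longlongrightarrow> c / a) at_top"
    using assms by (real_asymp simp: field_simps)
  ultimately have "((\<lambda>x. (a * x + b - 1) / (a * x + b) * ln (c * x / (a * x + b - 1))) \<longlongrightarrow> 1 * ln (c / a)) at_top"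
    using assms by (intro tendsto_mult tendsto_ln) auto
  then show ?thesis by simp
qed

section \<open>Spanning trees of the approximating graphs\<close>

locale approximating_graphs = boundary_cells +
  assumes connected: "mg_connected (G n)" and loopless: "mg_loopless (G n)"
begin

lemma finite_multigraph_G: "finite_multigraph (G n)"
proof
  show "finite (mg_verts (G n))" by (simp add: mg_verts_G finite_V)
  show "finite (mg_edges (G n))" using finite_V0 by (simp add: approx_graph_def finite_words)
  show "mg_ends (G n) e \<subseteq> mg_verts (G n)" if "e \<in> mg_edges (G n)" for e
    using that by (auto simp: approx_graph_def approx_verts_def)
qed

lemma tau_G_ge:
  assumes "card V0 > 2"
  shows "sqrt 3 ^ (card (V n) - 1) \<le> tau (G n)"
  using finite_multigraph.tau_ge_sqrt3_power[OF finite_multigraph_G connected loopless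
      triangle_G[OF loopless assms], of n]
  by (simp add: mg_verts_G)

lemma tree_G_iff: "mg_tree (G n) \<longleftrightarrow> card (V n) = Suc (card (mg_edges (G n)))"
  using finite_multigraph.tree_iff_card[OF finite_multigraph_G loopless] connected
  by (simp add: mg_verts_G)

text \<open>With at most one boundary point there are no edges, so connectedness leaves one vertex.
  With two, each cell is a single edge and the recurrence gives \<open>m ^ n + 1\<close> vertices.
  With more, the lower bound makes \<open>tau (G 1)\<close> exceed 1, so \<open>G 1\<close> is no
  tree.\<close>

lemma tau_G_eq_1:
  assumes tree: "mg_tree (G 1)"
  shows "tau (G n) = 1"
proof -
  consider "card V0 \<le> 1" | "card V0 = 2" | "card V0 > 2" by linarith
  then have "mg_tree (G n)"
  proof cases
    case 1
    then have "card (mg_edges (G n)) = 0" by (simp add: card_edges_G)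
    moreover have "card (V n) \<le> Suc (card (mg_edges (G n)))"
      using finite_multigraph.connected_card_verts_le[OF finite_multigraph_G connected, of n]
      by (simp add: mg_verts_G)
    moreover have "card (V n) > 0"
      using connected[of n] finite_V by (simp add: mg_connected_def mg_verts_G card_gt_0_iff)
    ultimately show ?thesis by (simp add: tree_G_iff)
  next
    case 2
    have "card (V 1) = Suc m" using tree 2 by (simp add: tree_G_iff card_edges_G)
    then have "real (card (V n)) = real m ^ n + 1"
    proof (induction n)
      case 0
      then show ?case using 2 by (simp add: approx_verts_0)
    next
      case (Suc n)
      then show ?case using 2 by (subst card_V_Suc) (simp add: algebra_simps)
    qed
    then have "card (V n) = Suc (m ^ n)" by (metis Suc_eq_plus1 of_nat_1 of_nat_add of_nat_eq_iff of_nat_power)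
    then show ?thesis using 2 by (simp add: tree_G_iff card_edges_G)
  next
    case 3
    then have "card (V 1) - 1 > 0" using card_V1_gt by simp
    then have "1 < sqrt 3 ^ (card (V 1) - 1)" by (intro one_less_power) auto
    also have "\<dots> \<le> tau (G 1)" by (rule tau_G_ge[OF 3])
    also have "tau (G 1) = 1"
      by (rule finite_multigraph.tau_tree[OF finite_multigraph_G tree loopless])
    finally show ?thesis by simp
  qed
  then show ?thesis by (rule finite_multigraph.tau_tree[OF finite_multigraph_G _ loopless])
qed

context
  assumes V0_gt: "card V0 > 2"
begin

text \<open>The coefficient of \<open>m ^ n\<close> in \<open>card (V n)\<close>, hence the limit of
  \<open>card (V n) / m ^ n\<close>.\<close>

definition "vertex_density = (real (card (V 1)) - real (card V0)) / (real m - 1)"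

lemma m_gt_1: "real m > 1"
  using m_ge_2 V0_gt by simp

lemma vertex_density_pos: "vertex_density > 0"
  using card_V1_gt V0_gt m_gt_1 by (simp add: vertex_density_def)

text \<open>The additive constant does not affect the limits and stays behind the
  quantifier.\<close>

lemma card_V_affine:
  "\<exists>b. \<forall>n. real (card (V n)) = vertex_density * real m ^ n + b"
proof (intro exI allI)
  fix n
  have "real (card (V n)) = ((real m - 1) * real (card (V n))) / (real m - 1)"
    using m_gt_1 by simp
  then show "real (card (V n)) = vertex_density * real m ^ n
      + (real m * real (card V0) - real (card (V 1))) / (real m - 1)"
    unfolding card_V vertex_density_def by (simp add: add_divide_distrib)
qed

lemma card_V_gt: "card (V n) > 2"
  using card_V_ge[of n] V0_gt by simp

lemma tau_G_pos: "tau (G n) > 0"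
proof -
  have "0 < sqrt 3 ^ (card (V n) - 1)" by simp
  then show ?thesis using tau_G_ge[OF V0_gt, of n] by linarith
qed

lemma filterlim_m_power: "filterlim (\<lambda>n. real m ^ n) at_top sequentially"
  using m_gt_1 by real_asymp

lemma card_V_div_tendsto: "(\<lambda>n. real (card (V n)) / real m ^ n) \<longlonglongrightarrow> vertex_density"
proof -
  obtain b where b: "\<And>n. real (card (V n)) = vertex_density * real m ^ n + b" using card_V_affine by blast
  from filterlim_compose[OF affine_div_tendsto filterlim_m_power] show ?thesis by (simp add: b)
qed

lemma card_V_bigtheta: "(\<lambda>n. real (card (V n))) \<in> \<Theta>(\<lambda>n. real m ^ n)"
  using card_V_div_tendsto vertex_density_pos m_gt_1 by (intro bigthetaI_tendsto) auto

lemma filterlim_card_V: "filterlim (\<lambda>n. real (card (V n))) at_top sequentially"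
proof -
  obtain b where b: "\<And>n. real (card (V n)) = vertex_density * real m ^ n + b" using card_V_affine by blast
  from filterlim_compose[OF filterlim_affine[OF vertex_density_pos] filterlim_m_power] show ?thesis by (simp add: b)
qed

text \<open>The logarithm of the bound in \<open>tau_G_ge\<close> divided by the number of vertices;
  \<open>upper_rate\<close> is the same for \<open>ln_tau_le\<close>.\<close>

definition "lower_rate n = (1 - 1 / real (card (V n))) * (ln 3 / 2)"

definition "upper_rate n = (real (card (V n)) - 1) / real (card (V n))
    * ln (2 * real (card (mg_edges (G n))) / (real (card (V n)) - 1))"

lemma lower_rate_le: "lower_rate n \<le> ln (tau (G n)) / real (card (V n))"
proof -
  have "ln (sqrt 3 ^ (card (V n) - 1)) \<le> ln (tau (G n))"
    using tau_G_ge[OF V0_gt, of n] tau_G_pos[of n] by (subst ln_le_cancel_iff) auto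
  then have "(real (card (V n)) - 1) * (ln 3 / 2) \<le> ln (tau (G n))"
    using card_V_gt[of n] by (simp add: ln_realpow ln_sqrt of_nat_diff)
  then have "(real (card (V n)) - 1) * (ln 3 / 2) / real (card (V n)) \<le> ln (tau (G n)) / real (card (V n))"
    by (rule divide_right_mono) simp
  moreover have "1 - 1 / real (card (V n)) = (real (card (V n)) - 1) / real (card (V n))"
    using card_V_gt[of n] by (simp add: diff_divide_distrib)
  ultimately show ?thesis by (simp add: lower_rate_def)
qed

lemma le_upper_rate: "ln (tau (G n)) / real (card (V n)) \<le> upper_rate n"
proof -
  have "ln (tau (G n)) \<le> (real (card (V n)) - 1) * ln (2 * real (card (mg_edges (G n))) / (real (card (V n)) - 1))"
    using finite_multigraph.ln_tau_le[OF finite_multigraph_G loopless tau_G_pos, of n] card_V_gt[of n]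
    by (simp add: mg_verts_G)
  then show ?thesis using divide_right_mono[of "ln (tau (G n))" _ "real (card (V n))"]
    by (simp add: upper_rate_def)
qed

lemma lower_rate_tendsto: "lower_rate \<longlonglongrightarrow> ln 3 / 2"
proof -
  have "((\<lambda>x. (1 - 1 / x) * (ln 3 / 2)) \<longlongrightarrow> ln 3 / 2) (at_top :: real filter)" by real_asymp
  from filterlim_compose[OF this filterlim_card_V] show ?thesis by (simp add: lower_rate_def[abs_def])
qed

lemma upper_rate_tendsto:
  "upper_rate \<longlonglongrightarrow> ln ((real m - 1) * real (card V0) * (real (card V0) - 1)
                      / (real (card (V 1)) - real (card V0)))"
proof -
  obtain b where b: "\<And>n. real (card (V n)) = vertex_density * real m ^ n + b" using card_V_affine by blast
  \<comment> \<open>Twice the number of edges of \<open>G n\<close> is \<open>c * m ^ n\<close>, so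
    the limit is the logarithm of \<open>c / vertex_density\<close>.\<close>
  define c where "c = real (card V0) * (real (card V0) - 1)"
  have "c > 0" using V0_gt by (simp add: c_def)
  from filterlim_compose[OF affine_ratio_tendsto[OF vertex_density_pos this, of b] filterlim_m_power]
  have "upper_rate \<longlonglongrightarrow> ln (c / vertex_density)"
    by (simp add: upper_rate_def[abs_def] two_card_edges_G b c_def mult.commute)
  then show ?thesis by (simp add: c_def vertex_density_def mult_ac)
qed

lemma ln_tau_bigtheta: "(\<lambda>n. ln (real (tau (G n)))) \<in> \<Theta>(\<lambda>n. real (card (V n)))"
proof -
  obtain L where L: "upper_rate \<longlonglongrightarrow> L" using upper_rate_tendsto by blast
  have "\<forall>\<^sub>F n in sequentially. upper_rate n < L + 1" using order_tendstoD(2)[OF L] by simp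
  \<comment> \<open>Any positive constant below the limit \<open>ln 3 / 2\<close> would do; above,
    \<open>\<bar>L\<bar> + 1\<close> is a positive bound whatever the sign of
    \<open>L\<close>.\<close>
  moreover have "\<forall>\<^sub>F n in sequentially. ln 3 / 4 < lower_rate n"
    using order_tendstoD(1)[OF lower_rate_tendsto, of "ln 3 / 4"] by simp
  ultimately have ev: "\<forall>\<^sub>F n in sequentially. ln 3 / 4 * real (card (V n)) \<le> ln (real (tau (G n))) \<and>
      ln (real (tau (G n))) \<le> (\<bar>L\<bar> + 1) * real (card (V n))"
  proof eventually_elim
    case (elim n)
    have "ln (tau (G n)) / real (card (V n)) \<le> \<bar>L\<bar> + 1" "ln 3 / 4 \<le> ln (tau (G n)) / real (card (V n))"
      using elim lower_rate_le[of n] le_upper_rate[of n] by linarith+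
    then show ?case using card_V_gt[of n] by (simp add: pos_divide_le_eq pos_le_divide_eq)
  qed
  show ?thesis
  proof (rule bigthetaI'[of "ln 3 / 4" "\<bar>L\<bar> + 1"])
    have nn: "ln (real (tau (G n))) \<ge> 0" for n using tau_G_pos[of n] by simp
    show "\<forall>\<^sub>F n in sequentially. ln 3 / 4 * norm (real (card (V n))) \<le> norm (ln (real (tau (G n)))) \<and>
        norm (ln (real (tau (G n)))) \<le> (\<bar>L\<bar> + 1) * norm (real (card (V n)))"
      using ev by eventually_elim (use nn in simp)
  qed auto
qed

lemma liminf_ge: "ereal (ln 3 / 2) \<le> liminf (\<lambda>n. ereal (ln (real (tau (G n))) / real (card (V n))))"
proof -
  have "(\<lambda>n. ereal (lower_rate n)) \<longlonglongrightarrow> ereal (ln 3 / 2)" using lower_rate_tendsto by simp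
  then have "ereal (ln 3 / 2) = liminf (\<lambda>n. ereal (lower_rate n))"
    by (intro lim_imp_Liminf[symmetric]) auto
  also have "\<dots> \<le> liminf (\<lambda>n. ereal (ln (real (tau (G n))) / real (card (V n))))"
    by (intro Liminf_mono always_eventually) (simp add: lower_rate_le)
  finally show ?thesis .
qed

lemma limsup_le:
  "limsup (\<lambda>n. ereal (ln (real (tau (G n))) / real (card (V n))))
     \<le> ereal (ln ((real m - 1) * real (card V0) * (real (card V0) - 1)
                   / (real (card (V 1)) - real (card V0))))" (is "_ \<le> ereal ?L")
proof -
  have "limsup (\<lambda>n. ereal (ln (real (tau (G n))) / real (card (V n)))) \<le> limsup (\<lambda>n. ereal (upper_rate n))"
    by (intro Limsup_mono always_eventually) (simp add: le_upper_rate)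
  also have "\<dots> = ereal ?L"
    using upper_rate_tendsto by (intro lim_imp_Limsup) auto
  finally show ?thesis .
qed

end

end

theorem theorem4p1:
  fixes m :: nat and f :: "nat \<Rightarrow> 'a::complete_space \<Rightarrow> 'a" and K V0 :: "'a set"
  defines "G \<equiv> approx_graph m f V0"
  defines "V \<equiv> approx_verts m f V0"
  assumes "\<And>i. i \<in> {1..m} \<Longrightarrow> injective_contraction (f i)"
    and "self_similar_set m f K"
    and "finitely_ramified m f K"
    and "boundary_set m f K V0"
    and "\<And>n. mg_connected (G n)"
    and "\<And>n. mg_loopless (G n)"
  shows "(mg_tree (G 1) \<longrightarrow> (\<forall>n. tau (G n) = 1)) \<and>
     (\<not> mg_tree (G 1) \<and> card V0 > 2 \<longrightarrow>
      (\<lambda>n. ln (real (tau (G n)))) \<in> \<Theta>(\<lambda>n. real (card (V n))) \<and>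
      \<Theta>(\<lambda>n. real (card (V n))) = \<Theta>(\<lambda>n. real m ^ n) \<and>
      ereal (ln 3 / 2) \<le> liminf (\<lambda>n. ereal (ln (real (tau (G n))) / real (card (V n)))) \<and>
      liminf (\<lambda>n. ereal (ln (real (tau (G n))) / real (card (V n))))
        \<le> limsup (\<lambda>n. ereal (ln (real (tau (G n))) / real (card (V n)))) \<and>
      limsup (\<lambda>n. ereal (ln (real (tau (G n))) / real (card (V n))))
        \<le> ereal (ln ((real m - 1) * real (card V0) * (real (card V0) - 1)
                      / (real (card (V 1)) - real (card V0)))))"
proof -
  interpret approximating_graphs m f K V0
    using assms unfolding G_def by unfold_locales
  show ?thesis
    unfolding G_def V_def
    using tau_G_eq_1 ln_tau_bigtheta card_V_bigtheta liminf_ge limsup_le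
    by (auto intro!: landau_theta.cong_bigtheta Liminf_le_Limsup)
qed

end
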